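(* Let $b\in W$ be the element determined by the recursion relation $b=(b,b\sigma)\,\sigma$. Then $$\Phi_b\ =\ 1+\sum_{m\ge1}\ \sum_{2^{m-1}\le n<2^m}2^{n-m}X^mY^n.$$
   Context: Let $T$ be the infinite rooted regular binary tree whose vertices are the finite words over $\{0,1\}$, with root the empty word, each word $t$ being joined by an edge to the words $0t$ and $1t$. Level $n$ of $T$ is the set of words of length $n$. Let $W=\mathrm{Aut}(T)$ be the automorphism group of $T$ (products are compositions, $(uv)(t)=u(v(t))$). For $u,v\in W$, let $(u,v)\in W$ be the automorphism fixing the root and given by $t0\mapsto u(t)0$ and $t1\mapsto v(t)1$ for every word $t$. Let $\sigma\in W$ be the involution fixing the root with $t0\mapsto t1$ and $t1\mapsto t0$ for every word $t$. For $w\in W$, every orbit of $w$ on level $n$ has length $2^m$ for some $0\le m\le n$. The orbit length generating function of $w$ is $\Phi_w=\sum_{n\ge m\ge 0}o_{m,n}(w)X^mY^n\in 1+Y\mathbb{Z}[[X,Y]]$, where $o_{m,n}(w)$ is the number of orbits of $w$ of length $2^m$ on level $n$. *)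

theory Defs
  imports
    "HOL-Analysis.Analysis"
    "HOL-Computational_Algebra.Formal_Power_Series"
    "HOL-Combinatorics.Orbits"
begin

text \<open>
  The letters \<open>0\<close> and \<open>1\<close> are \<^const>\<open>False\<close> and \<^const>\<open>True\<close>; the leftmost letter of a word is the
  head of the list.  The children of \<open>t\<close> arise by \<^emph>\<open>prepending\<close> a letter, so the branch at the root
  into which a nonempty word falls is given by its last letter.
\<close>

type_synonym word = "bool list"

definition level :: "nat \<Rightarrow> word set" where
  "level n = {t. length t = n}"

definition tree_adj :: "word \<Rightarrow> word \<Rightarrow> bool" where
  "tree_adj s t \<longleftrightarrow> (\<exists>x. t = x # s) \<or> (\<exists>x. s = x # t)"

text \<open>
  Fixing the root need not be required: the root is the only vertex of degree two.
\<close>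

definition Aut_T :: "(word \<Rightarrow> word) set" where
  "Aut_T = {w. bij w \<and> (\<forall>s t. tree_adj (w s) (w t) \<longleftrightarrow> tree_adj s t)}"

definition aut_pair :: "(word \<Rightarrow> word) \<Rightarrow> (word \<Rightarrow> word) \<Rightarrow> word \<Rightarrow> word" where
  "aut_pair u v s =
     (if s = [] then []
      else if last s then v (butlast s) @ [True]
      else u (butlast s) @ [False])"

definition aut_swap :: "word \<Rightarrow> word"  (\<open>\<sigma>\<close>) where
  "\<sigma> s = (if s = [] then [] else butlast s @ [\<not> last s])"

lemma aut_pair_simps [simp]:
  "aut_pair u v [] = []"
  "aut_pair u v (t @ [False]) = u t @ [False]"
  "aut_pair u v (t @ [True]) = v t @ [True]"
  by (simp_all add: aut_pair_def)

lemma aut_swap_simps [simp]: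
  "\<sigma> [] = []"
  "\<sigma> (t @ [x]) = t @ [\<not> x]"
  by (simp_all add: aut_swap_def)

text \<open>
  The library's \<^const>\<open>orbit\<close> collects the forward iterates \<open>w t, w (w t), \<dots>\<close>.  An automorphism
  permutes the finite level of \<open>t\<close>, so this is the orbit of \<open>t\<close> under the group generated by \<open>w\<close>.
\<close>

definition num_orbits :: "nat \<Rightarrow> nat \<Rightarrow> (word \<Rightarrow> word) \<Rightarrow> nat" where
  "num_orbits m n w = card {Q \<in> orbit w ` level n. card Q = 2 ^ m}"

text \<open>
  Power series in \<open>X\<close> and \<open>Y\<close> over the integers are taken as power series in \<open>Y\<close> with coefficients
  in \<open>\<int>[[X]]\<close>, so that \<open>X\<close> is a constant of the outer ring.
\<close>

abbreviation series_X :: "int fps fps"  (\<open>\<X>\<close>) where "\<X> \<equiv> fps_const fps_X"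
abbreviation series_Y :: "int fps fps"  (\<open>\<Y>\<close>) where "\<Y> \<equiv> fps_X"

definition orbit_gf :: "(word \<Rightarrow> word) \<Rightarrow> int fps fps"  (\<open>\<Phi>\<close>) where
  "\<Phi> w = Abs_fps (\<lambda>n. \<Sum>m\<le>n. of_nat (num_orbits m n w) * fps_X ^ m)"

text \<open>
  The recursion \<open>b = (b, b\<sigma>)\<sigma>\<close> determines a unique automorphism.  It is computed by the following
  function on reversed words, for which the root branch is the head of the list.
\<close>

fun flip_hd :: "word \<Rightarrow> word" where
  "flip_hd [] = []"
| "flip_hd (x # r) = (\<not> x) # r"

lemma length_flip_hd [simp]: "length (flip_hd r) = length r"
  by (cases r) auto

lemma flip_hd_flip_hd [simp]: "flip_hd (flip_hd r) = r"
  by (cases r) auto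

lemma rev_aut_swap: "\<sigma> s = rev (flip_hd (rev s))"
  by (cases s rule: rev_cases) auto

function rev_b :: "word \<Rightarrow> word" where
  "rev_b [] = []"
| "rev_b (True # r) = False # rev_b r"
| "rev_b (False # r) = True # rev_b (flip_hd r)"
  by pat_completeness auto
termination by (relation "inv_image less_than length") auto

lemma length_rev_b [simp]: "length (rev_b r) = length r"
  by (induction r rule: rev_b.induct) auto

lemma rev_b_inj: "rev_b r = rev_b s \<Longrightarrow> r = s"
proof (induction r arbitrary: s rule: rev_b.induct)
  case 1
  then show ?case by (metis length_rev_b length_0_conv)
next
  case (2 r)
  then show ?case by (cases s rule: rev_b.cases) auto
next
  case (3 r)
  then show ?case by (cases s rule: rev_b.cases) (auto, metis flip_hd_flip_hd)
qed

lemma rev_b_surj: "\<exists>r. rev_b r = s"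
proof (induction s)
  case Nil
  show ?case by (rule exI [of _ "[]"]) simp
next
  case (Cons x s)
  then obtain r where r: "rev_b r = s" by blast
  show ?case
  proof (cases x)
    case True
    with r show ?thesis by (intro exI [of _ "False # flip_hd r"]) simp
  next
    case False
    with r show ?thesis by (intro exI [of _ "True # r"]) simp
  qed
qed

lemma rev_b_snoc: "\<exists>y. rev_b (r @ [x]) = rev_b r @ [y]"
proof (induction r arbitrary: x rule: rev_b.induct)
  case 1
  show ?case by (cases x) auto
next
  case (2 r)
  then show ?case by auto
next
  case (3 r)
  show ?case
  proof (cases r)
    case Nil
    then show ?thesis by (cases x) auto
  next
    case (Cons a r')
    with 3 [of x] show ?thesis by simp
  qed
qed

lemma aut_b_ex1: "\<exists>!b. b \<in> Aut_T \<and> b = aut_pair b (b \<circ> \<sigma>) \<circ> \<sigma>"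
proof (rule ex1I)
  let ?b = "\<lambda>s. rev (rev_b (rev s))"
  have rec: "?b = aut_pair ?b (?b \<circ> \<sigma>) \<circ> \<sigma>"
  proof
    fix s show "?b s = (aut_pair ?b (?b \<circ> \<sigma>) \<circ> \<sigma>) s"
    proof (cases s rule: rev_cases)
      case (snoc t x)
      then show ?thesis by (cases x) (auto simp: rev_aut_swap [of t])
    qed simp
  qed
  have "inj ?b"
    by (rule injI) (metis rev_b_inj rev_rev_ident)
  moreover have "surj ?b"
    unfolding surj_def by (metis rev_b_surj rev_rev_ident)
  moreover have child: "\<exists>y. ?b (x # s) = y # ?b s" for x s
    using rev_b_snoc [of "rev s" x] by auto
  have "tree_adj (?b s) (?b t) \<longleftrightarrow> tree_adj s t" for s t
  proof
    assume "tree_adj s t"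
    then show "tree_adj (?b s) (?b t)"
      unfolding tree_adj_def using child by metis
  next
    have *: "\<exists>x. t = x # s" if y: "?b t = y # ?b s" for s t y
    proof (cases t)
      case Nil
      with y show ?thesis by simp
    next
      case (Cons x t')
      with child [of x t'] y have "?b t' = ?b s" by auto
      with \<open>inj ?b\<close> have "t' = s" by (rule injD)
      with Cons show ?thesis by simp
    qed
    assume "tree_adj (?b s) (?b t)"
    then show "tree_adj s t"
      unfolding tree_adj_def using * by meson
  qed
  ultimately show "?b \<in> Aut_T \<and> ?b = aut_pair ?b (?b \<circ> \<sigma>) \<circ> \<sigma>"
    using rec by (simp add: Aut_T_def bij_def)
  fix b assume b: "b \<in> Aut_T \<and> b = aut_pair b (b \<circ> \<sigma>) \<circ> \<sigma>"
  then have eq: "b s = aut_pair b (b \<circ> \<sigma>) (\<sigma> s)" for s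
    by (metis comp_apply)
  have "b (rev r) = rev (rev_b r)" for r
  proof (induction r rule: rev_b.induct)
    case 1
    show ?case by (subst eq) simp
  next
    case (2 r)
    then show ?case by (subst eq) simp
  next
    case (3 r)
    then show ?case by (subst eq) (simp add: rev_aut_swap)
  qed
  then show "b = ?b"
    by (metis rev_rev_ident)
qed

end

theory Submission
  imports Defs
begin

text \<open>
  Attach to a word \<open>x\<^sub>0, x\<^sub>1, \<dots>, x\<^bsub>n-1\<^esub>\<close>, read from the root, the power series
  \<open>1 + (x\<^sub>0 + 1) Z + \<dots> + (x\<^bsub>n-1\<^esub> + 1) Z ^ n\<close> over the field with two elements, modulo
  \<open>Z ^ (n + 1)\<close>.  In these coordinates \<open>b\<close> is multiplication by the inverse of \<open>1 + Z\<close>.  Since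
  \<open>(1 + Z) ^ (2 ^ j) = 1 + Z ^ (2 ^ j)\<close> and the series are units, \<open>b ^ (2 ^ j)\<close> fixes a word of
  length \<open>n\<close> iff \<open>n < 2 ^ j\<close>.  Hence all orbits on a level have the same length.
\<close>

section \<open>Orbits of a self-map: length and number\<close>

text \<open>The least period of \<open>x\<close> divides \<open>2 ^ Suc k\<close>, so it is a power
  of two; a smaller power would divide \<open>2 ^ k\<close> and make that a period as well.\<close>

lemma card_orbit_eq_power2:
  assumes "(f ^^ (2 ^ Suc k)) x = x" and "(f ^^ (2 ^ k)) x \<noteq> x"
  shows "card (orbit f x) = 2 ^ Suc k"
proof -
  define p where "p = funpow_dist1 f x x"
  have self: "x \<in> orbit f x"
    using assms(1) unfolding orbit_altdef by (metis (mono_tags, lifting) mem_Collect_eq zero_less_numeral zero_less_power)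
  have p: "(f ^^ p) x = x" "p > 0"
    using funpow_dist1_prop [OF self] by (simp_all add: p_def)
  \<comment> \<open>The remainder modulo \<open>p\<close> is again a return time, and it lies below
    the least positive one, so it must vanish.\<close>
  have "(f ^^ (2 ^ Suc k mod p)) x = x"
    using funpow_mod_eq [OF p(1), of "2 ^ Suc k"] assms(1) by simp
  moreover have "2 ^ Suc k mod p < p"
    using p(2) by simp
  ultimately have "2 ^ Suc k mod p = 0"
    using funpow_dist1_least [of "2 ^ Suc k mod p" f x x] by (auto simp: p_def)
  then have "p dvd 2 ^ Suc k"
    by presburger
  then obtain i where i: "i \<le> Suc k" "p = 2 ^ i"
    using divides_primepow_nat [OF two_is_prime_nat] by blast
  have "i = Suc k"
  proof (rule ccontr)
    assume "i \<noteq> Suc k"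
    with i have "p dvd 2 ^ k"
      by (simp add: le_imp_power_dvd)
    then have "(f ^^ (2 ^ k)) x = x"
      using funpow_mod_eq [OF p(1), of "2 ^ k"] by (simp add: dvd_imp_mod_0)
    with assms(2) show False by contradiction
  qed
  moreover have "card (orbit f x) = p"
    unfolding orbit_conv_funpow_dist1 [OF self] p_def
    by (simp add: card_image inj_on_funpow_dist1 [OF self])
  ultimately show ?thesis
    using i by simp
qed

text \<open>Orbits that meet coincide, so they partition \<open>S\<close> into blocks of size
  \<open>k\<close>.\<close>

lemma card_orbits_of_const_card:
  assumes "finite S" and inv: "\<And>x. x \<in> S \<Longrightarrow> f x \<in> S"
    and self: "\<And>x. x \<in> S \<Longrightarrow> x \<in> orbit f x"
    and const: "\<And>x. x \<in> S \<Longrightarrow> card (orbit f x) = k"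
  shows "k * card (orbit f ` S) = card S"
proof -
  have sub: "orbit f x \<subseteq> S" if "x \<in> S" for x
  proof
    fix y assume "y \<in> orbit f x"
    then show "y \<in> S"
      by induction (use that inv in auto)
  qed
  then have un: "\<Union> (orbit f ` S) = S"
    using self by blast
  have "orbit f x = orbit f y" if "x \<in> S" "y \<in> S" "orbit f x \<inter> orbit f y \<noteq> {}" for x y
  proof -
    from that(3) obtain z where "z \<in> orbit f x" "z \<in> orbit f y"
      by blast
    moreover have "cyclic_on f (orbit f x)" "cyclic_on f (orbit f y)"
      using self that by (auto simp: cyclic_on_def)
    ultimately show ?thesis
      by (metis orbit_cyclic_eq3)
  qed
  then have "k * card (orbit f ` S) = card (\<Union> (orbit f ` S))"
    by (intro card_partition) (use assms un in auto)
  then show ?thesis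
    by (simp add: un)
qed

lemma finite_level: "finite (level n)" and card_level: "card (level n) = 2 ^ n"
  using finite_lists_length_eq [of "UNIV :: bool set" n] card_lists_length_eq [of "UNIV :: bool set" n]
  by (simp_all add: level_def)

lemma length_aut_swap: "length (\<sigma> t) = length t"
  by (cases t rule: rev_cases) auto

section \<open>Power series coordinates on words\<close>

definition coords :: "word \<Rightarrow> bool list" where
  "coords t = True # map Not (rev t)"

lemma length_coords [simp]: "length (coords t) = Suc (length t)"
  by (simp add: coords_def)

lemma coords_nth_0 [simp]: "coords t ! 0"
  by (simp add: coords_def)

lemma inj_coords: "inj coords"
proof (rule injI)
  fix s t assume "coords s = coords t"
  moreover have "inj Not" by (simp add: inj_def)
  ultimately show "s = t" by (simp add: coords_def inj_map_eq_map)
qed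

lemma coords_snoc_nth_Suc:
  "coords (t @ [x]) ! Suc k = (if k = 0 then \<not> x else coords t ! k)"
  by (cases k) (auto simp: coords_def)

text \<open>In coordinates \<open>\<sigma>\<close> adds Z: it changes the letter next to the root,
  which is the coefficient of index 1 because index 0 holds the constant 1.\<close>

lemma coords_aut_swap_nth:
  assumes "k \<le> length t"
  shows "coords (\<sigma> t) ! k = (coords t ! k \<noteq> (k = 1))"
  using assms
  by (cases t rule: rev_cases; cases k) (auto simp: coords_snoc_nth_Suc)

section \<open>The powers of \<open>b\<close> in coordinates and their fixed words\<close>

context
  fixes b :: "word \<Rightarrow> word"
  assumes rec: "b = aut_pair b (b \<circ> \<sigma>) \<circ> \<sigma>"
begin

lemma b_Nil: "b [] = []"
  by (subst rec) simp

lemma b_snoc: "b (t @ [x]) = (if x then b t @ [False] else b (\<sigma> t) @ [True])"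
  by (subst rec) simp

lemma length_b: "length (b t) = length t"
proof (induction t rule: measure_induct_rule [of length])
  case (less t)
  then show ?case
    by (cases t rule: rev_cases) (auto simp: b_Nil b_snoc length_aut_swap)
qed

lemma length_funpow_b: "length ((b ^^ i) t) = length t"
  by (induction i) (simp_all add: length_b)

text \<open>Writing C(t) for the series of \<open>t\<close>, this is C(t) = (1 + Z) C(b t). It
  follows by induction from C(t @ [x]) = 1 + Z (C(t) + x) and the recursion.\<close>

lemma coords_b_nth:
  assumes "k \<le> length t"
  shows "coords t ! k = (coords (b t) ! k \<noteq> (1 \<le> k \<and> coords (b t) ! (k - 1)))"
  using assms
\<comment> \<open>The recursion may pass to \<open>\<sigma> t'\<close>, which has the length of
  \<open>t'\<close> but is not a part of \<open>t\<close>; hence induction on length.\<close>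
proof (induction t arbitrary: k rule: measure_induct_rule [of length])
  case (less t)
  show ?case
  proof (cases k)
    case 0
    then show ?thesis by simp
  next
    case k: (Suc i)
    with less.prems obtain t' x where t: "t = t' @ [x]"
      by (cases t rule: rev_cases) auto
    have IH: "coords s ! i = (coords (b s) ! i \<noteq> (1 \<le> i \<and> coords (b s) ! (i - 1)))"
      if "length s = length t'" for s
      using that less.prems k t by (intro less.IH) auto
    have i: "i \<le> length t'"
      using less.prems k t by simp
    show ?thesis
    proof (cases i)
      case 0
      then show ?thesis
        by (simp add: k t b_snoc coords_snoc_nth_Suc)
    next
      \<comment> \<open>The only delicate index is \<open>j = 0\<close>: there
        \<open>coords (b t) ! 1\<close> is \<open>x\<close>, whereas the induction hypothesis has
        the constant coefficient \<open>True\<close>. They differ exactly if \<open>x\<close> is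
        \<open>False\<close>, and then \<open>\<sigma>\<close> flips coefficient 1 of
        \<open>t'\<close>, which compensates.\<close>
      case i': (Suc j)
      then show ?thesis
        using IH [of t'] IH [of "\<sigma> t'"] coords_aut_swap_nth [OF i]
        by (cases j) (auto simp: k t b_snoc coords_snoc_nth_Suc length_aut_swap split: if_splits)
    qed
  qed
qed

text \<open>Induction on \<open>j\<close> by squaring: (1 + Z^p)^2 = 1 + Z^(2p) in characteristic
  two.\<close>

lemma coords_b_power2_nth:
  assumes "k \<le> length t"
  shows "coords t ! k = (coords ((b ^^ (2 ^ j)) t) ! k \<noteq>
    (2 ^ j \<le> k \<and> coords ((b ^^ (2 ^ j)) t) ! (k - 2 ^ j)))"
  using assms
proof (induction j arbitrary: t k)
  case 0
  then show ?case using coords_b_nth by simp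
next
  case (Suc j)
  define p :: nat where "p = 2 ^ j"
  define u where "u = (b ^^ p) t"
  define s where "s = (b ^^ p) u"
  have p: "2 ^ Suc j = p + p"
    by (simp add: p_def)
  then have s: "(b ^^ (2 ^ Suc j)) t = s"
    by (simp add: s_def u_def funpow_add)
  have "coords t ! k = (coords u ! k \<noteq> (p \<le> k \<and> coords u ! (k - p)))"
    using Suc.IH [OF Suc.prems] by (simp add: u_def p_def)
  moreover have "coords u ! i = (coords s ! i \<noteq> (p \<le> i \<and> coords s ! (i - p)))" if "i \<le> k" for i
    using Suc.IH [of i u] that Suc.prems by (simp add: s_def u_def p_def length_funpow_b)
  ultimately have "coords t ! k = ((coords s ! k \<noteq> (p \<le> k \<and> coords s ! (k - p))) \<noteq>
      (p \<le> k \<and> (coords s ! (k - p) \<noteq> (p \<le> k - p \<and> coords s ! (k - p - p)))))"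
    by simp
  \<comment> \<open>The two copies of \<open>coords s ! (k - p)\<close> cancel; what remains is to
    match the index ranges.\<close>
  moreover have "p + p \<le> k \<longleftrightarrow> p \<le> k \<and> p \<le> k - p"
    by linarith
  ultimately show ?case
    unfolding s unfolding p diff_diff_left by blast
qed

lemma b_power2_fixes_iff: "(b ^^ (2 ^ j)) t = t \<longleftrightarrow> length t < 2 ^ j"
proof
  assume fixed: "(b ^^ (2 ^ j)) t = t"
  show "length t < 2 ^ j"
  proof (rule ccontr)
    assume "\<not> length t < 2 ^ j"
    then have "2 ^ j \<le> length t"
      by simp
    \<comment> \<open>At index \<open>2 ^ j\<close> the shifted term is the constant coefficient
      \<open>True\<close>, so a fixed word would have a coefficient equal to its own
      negation.\<close>
    from coords_b_power2_nth [OF this, of j] show False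
      unfolding fixed by simp
  qed
next
  assume less: "length t < 2 ^ j"
  have "coords ((b ^^ (2 ^ j)) t) = coords t"
  proof (rule nth_equalityI)
    fix i assume "i < length (coords ((b ^^ (2 ^ j)) t))"
    then have "i \<le> length t"
      by (simp add: length_funpow_b)
    \<comment> \<open>All indices lie below \<open>2 ^ j\<close>, so the shifted term is
      absent.\<close>
    with coords_b_power2_nth [OF this, of j] less
    show "coords ((b ^^ (2 ^ j)) t) ! i = coords t ! i"
      by auto
  qed (simp add: length_funpow_b)
  then show "(b ^^ (2 ^ j)) t = t"
    using inj_coords by (simp add: inj_eq)
qed

lemma self_in_orbit_b: "t \<in> orbit b t"
proof -
  have "(b ^^ (2 ^ length t)) t = t"
    by (simp add: b_power2_fixes_iff)
  then show ?thesis
    unfolding orbit_altdef by (metis (mono_tags, lifting) mem_Collect_eq zero_less_numeral zero_less_power)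
qed

lemma num_orbits_b:
  assumes "2 ^ (m - 1) \<le> n" and "n < 2 ^ m"
  shows "num_orbits i n b = (if i = m then 2 ^ (n - m) else 0)"
proof -
  \<comment> \<open>For \<open>m = 0\<close> truncated subtraction would give
    \<open>1 \<le> n\<close> and \<open>n < 1\<close>.\<close>
  obtain l where m: "m = Suc l"
    using assms by (cases m) auto
  have card: "card (orbit b t) = 2 ^ m" if "t \<in> level n" for t
    using that assms unfolding m
    by (intro card_orbit_eq_power2) (auto simp only: b_power2_fixes_iff level_def, simp)
  have "2 ^ m * card (orbit b ` level n) = 2 ^ n"
    using card_orbits_of_const_card [of "level n" b "2 ^ m"] self_in_orbit_b card
    by (simp add: finite_level card_level) (simp add: level_def length_b)
  \<comment> \<open>This makes \<open>n - m\<close> a genuine difference: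
    \<open>m - 1 < 2 ^ (m - 1) \<le> n\<close>.\<close>
  moreover have "m \<le> n"
    using less_le_trans [OF less_exp assms(1)] by simp
  then have "(2 :: nat) ^ n = 2 ^ m * 2 ^ (n - m)"
    by (simp flip: power_add)
  ultimately have "card (orbit b ` level n) = 2 ^ (n - m)"
    by simp
  moreover have "{Q \<in> orbit b ` level n. card Q = 2 ^ i} = (if i = m then orbit b ` level n else {})"
    using card by auto
  ultimately show ?thesis
    by (simp add: num_orbits_def)
qed

lemma num_orbits_b_0: "num_orbits 0 0 b = 1"
proof -
  have "orbit b [] = {[]}"
    by (simp add: orbit_eq_singleton_iff b_Nil)
  then have "orbit b ` level 0 = {{[]}}"
    by (simp add: level_def)
  then have "{Q \<in> orbit b ` level 0. card Q = 2 ^ 0} = {{[]}}"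
    by auto
  then show ?thesis
    by (simp add: num_orbits_def)
qed

end

section \<open>Binary length of the level and summation of the series\<close>

lemma ex_bit_length:
  assumes "(n :: nat) > 0"
  obtains m where "m \<ge> 1" "2 ^ (m - 1) \<le> n" "n < 2 ^ m"
  using ex_power_ivl1 [of 2 n] assms that [of "Suc m" for m] by auto

lemma bit_length_unique:
  assumes "2 ^ (m - 1) \<le> (n :: nat)" "n < 2 ^ m" "2 ^ (m' - 1) \<le> n" "n < 2 ^ m'"
  shows "m = m'"
proof -
  have "m - 1 < m'" "m' - 1 < m"
    using assms by (meson le_less_trans nat_power_less_imp_less zero_less_numeral)+
  with assms show ?thesis by linarith
qed

lemma fps_nth_summand:
  "fps_nth (\<Sum>n\<in>{2 ^ (m - 1)..<2 ^ m}. 2 ^ (n - m) * \<X> ^ m * \<Y> ^ n) N =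
    (if 2 ^ (m - 1) \<le> N \<and> N < 2 ^ m then 2 ^ (N - m) * fps_X ^ m else 0)"
proof -
  have "fps_nth (2 ^ (n - m) * \<X> ^ m * \<Y> ^ n) N = (if N = n then 2 ^ (n - m) * fps_X ^ m else 0)" for n
  proof -
    have "2 ^ (n - m) * \<X> ^ m = fps_const (2 ^ (n - m) * fps_X ^ m)"
      by (simp only: numeral_fps_const fps_const_power fps_const_mult)
    then show ?thesis
      by (simp only:) (auto simp: fps_X_power_mult_right_nth)
  qed
  then show ?thesis
    by (simp add: fps_sum_nth)
qed

theorem proposition3p6:
  fixes b :: "word \<Rightarrow> word"
  assumes "b \<in> Aut_T"
    and "b = aut_pair b (b \<circ> \<sigma>) \<circ> \<sigma>"
  shows "\<Phi> b = 1 + (\<Sum>\<^sub>\<infinity>m\<in>{1..}. \<Sum>n\<in>{2 ^ (m - 1)..<2 ^ m}. 2 ^ (n - m) * \<X> ^ m * \<Y> ^ n)"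
proof -
  define F where "F m = (\<Sum>n\<in>{2 ^ (m - 1)..<2 ^ m}. 2 ^ (n - m) * \<X> ^ m * \<Y> ^ n)" for m :: nat
  have F_nth: "fps_nth (F m) N = (if 2 ^ (m - 1) \<le> N \<and> N < 2 ^ m then 2 ^ (N - m) * fps_X ^ m else 0)" for m N
    unfolding F_def by (rule fps_nth_summand)
  \<comment> \<open>These are the \<open>m\<close> that contribute to the coefficient of Y^N: only
    the binary length of \<open>N\<close> if \<open>N > 0\<close>, and none if
    \<open>N = 0\<close>.\<close>
  define A where "A N = {m\<in>{1..}. fps_nth (F m) N \<noteq> 0}" for N
  have A: "A N = {m. m \<ge> 1 \<and> 2 ^ (m - 1) \<le> N \<and> N < 2 ^ m}" for N
    by (auto simp: A_def F_nth)
  have A_pos: "\<exists>m\<le>N. A N = {m} \<and> 2 ^ (m - 1) \<le> N \<and> N < 2 ^ m" if "N > 0" for N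
  proof -
    obtain m where m: "m \<ge> 1" "2 ^ (m - 1) \<le> N" "N < 2 ^ m"
      using ex_bit_length \<open>N > 0\<close> by metis
    then have "A N = {m}"
      using bit_length_unique by (auto simp: A)
    moreover have "m \<le> N"
      using less_le_trans [OF less_exp m(2)] by simp
    ultimately show ?thesis
      using m by blast
  qed
  have A_0: "A 0 = {}"
    by (simp add: A)
  have "(F has_sum (\<Phi> b - 1)) {1..}"
  \<comment> \<open>Convergence is checked coefficientwise in Y, each coefficient receiving finitely
    many nonzero summands. The root level accounts for the separate term 1.\<close>
  proof (rule has_sum_fpsI; unfold A_def [symmetric])
    fix N
    show "finite (A N)"
      using A_pos [of N] A_0 by (cases "N = 0") auto
    show "fps_nth (\<Phi> b - 1) N = (\<Sum>m\<in>A N. fps_nth (F m) N)"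
    proof (cases "N = 0")
      case True
      then show ?thesis
        using num_orbits_b_0 [OF assms(2)] by (simp add: A_0 orbit_gf_def)
    next
      case False
      then obtain m where m: "m \<le> N" "A N = {m}" "2 ^ (m - 1) \<le> N" "N < 2 ^ m"
        using A_pos by blast
      have "fps_nth (\<Phi> b) N = (\<Sum>i\<le>N. if i = m then 2 ^ (N - m) * fps_X ^ m else 0)"
        unfolding orbit_gf_def fps_nth_Abs_fps
        by (intro sum.cong) (simp_all add: num_orbits_b [OF assms(2) m(3,4)])
      with m False show ?thesis
        by (simp add: F_nth)
    qed
  qed
  then have "infsum F {1..} = \<Phi> b - 1"
    by (rule infsumI)
  then have "\<Phi> b = 1 + infsum F {1..}"
    by simp
  then show ?thesis
    unfolding F_def .
qed

end
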